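(* Let $\mathcal{A} = (a_{i_1\cdots i_m})$ be an $m$th order $n$-dimensional strongly symmetric, hierarchically dominated nonnegative tensor, and let $\mathcal{A}^{(0)},\mathcal{A}^{(1)},\dots,\mathcal{A}^{(m)}$ be the tensors produced from $\mathcal{A}$ by the hierarchical elimination algorithm. Then $\mathcal{A}^{(k)}$ is nonnegative for $k=0,\dots,m-1$. Thus, $\mathcal{A}$ is a completely positive tensor; that is, every strongly symmetric, hierarchically dominated nonnegative tensor is completely positive.
   Context: A real $m$th order $n$-dimensional tensor is an array $\mathcal{A} = (a_{i_1\cdots i_m})$ of real numbers indexed by $\mathcal{I}=\{(i_1,\dots,i_m): 1\le i_k\le n,\ k=1,\dots,m\}$; it is nonnegative if all its entries are nonnegative. For $u\in\mathbb{R}^n$, $u^m$ denotes the rank-one tensor $(u_{i_1}\cdots u_{i_m})$. $\mathcal{A}$ is completely positive (CP) if there are finitely many componentwise nonnegative vectors $u^{(1)},\dots,u^{(r)}\in\mathbb{R}^n$ with $\mathcal{A}=\sum_{k=1}^r (u^{(k)})^m$. For $(i_1,\dots,i_m)\in\mathcal{I}$, $[(i_1,\dots,i_m)]$ is the set of distinct members of $\{i_1,\dots,i_m\}$. Write $(i_1,\dots,i_m)\preceq(j_1,\dots,j_m)$ if $[(i_1,\dots,i_m)]\subseteq[(j_1,\dots,j_m)]$ and $(i_1,\dots,i_m)\sim(j_1,\dots,j_m)$ if $[(i_1,\dots,i_m)]=[(j_1,\dots,j_m)]$. $\mathcal{A}$ is strongly symmetric if $a_{i_1\cdots i_m}=a_{j_1\cdots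 j_m}$ whenever $(i_1,\dots,i_m)\sim(j_1,\dots,j_m)$. For $k=1,\dots,m$, $\mathcal{I}_{k+}$ is the set of tuples $(i_1,\dots,i_k,i_k,\dots,i_k)\in\mathcal{I}$ (the last index $i_k$ repeated to fill length $m$) with $1\le i_1<i_2<\cdots<i_k\le n$. For a tensor $\mathcal{A}$, $\mathcal{I}_{k+}(\mathcal{A})$ is the set of those $(i_1,\dots,i_k,i_k,\dots,i_k)\in\mathcal{I}_{k+}$ with $a_{i_1\cdots i_ki_k\cdots i_k}\ne 0$. For $p=1,\dots,m-1$ and $(i_1,\dots,i_p,i_p,\dots,i_p)\in\mathcal{I}_{p+}$, $\mathcal{J}_1(i_1,\dots,i_p)$ is the set of $(j_1,\dots,j_{p+1},\dots,j_{p+1})\in\mathcal{I}_{(p+1)+}$ with $(i_1,\dots,i_p,\dots,i_p)\preceq(j_1,\dots,j_{p+1},\dots,j_{p+1})$. A strongly symmetric nonnegative tensor $\mathcal{A}$ is hierarchically dominated if for all $p=1,\dots,m-1$ and all $(i_1,\dots,i_p,i_p,\dots,i_p)\in\mathcal{I}_{p+}$, $$a_{i_1\cdots i_pi_p\cdots i_p}\ge\sum\left\{a_{j_1\cdots j_{p+1}\cdots j_{p+1}} : (j_1,\dots,j_{p+1},\dots,j_{p+1})\in\mathcal{J}_1(i_1,\dots,i_p)\right\}.$$ Hierarchical elimination algorithm: set $\mathcal{A}^{(0)}=\mathcal{A}$. For $k=0,1,\dots,m-1$ successively: for each $e=(i_1,\dots,i_{m-k},\dots,i_{m-k})\in\mathcal{I}_{(m-k)+}(\mathcal{A}^{(k)})$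 let $v^e\in\mathbb{R}^n$ be the vector with $v^e_i=1$ if $i\in\{i_1,\dots,i_{m-k}\}$ and $v^e_i=0$ otherwise, and set $$\mathcal{A}^{(k+1)}=\mathcal{A}^{(k)}-\sum\left\{a^{(k)}_{i_1\cdots i_{m-k}\cdots i_{m-k}}\,(v^e)^m : e=(i_1,\dots,i_{m-k},\dots,i_{m-k})\in\mathcal{I}_{(m-k)+}(\mathcal{A}^{(k)})\right\},$$ where $a^{(k)}_{i_1\cdots i_m}$ are the entries of $\mathcal{A}^{(k)}$ and empty sums are zero. *)

theory Defs
  imports Complex_Main
begin

text \<open>
  A tensor of order m and dimension n is a function on index tuples. Tuples are lists of
  natural numbers, and only the values at the tuples in the set \<open>indices m n\<close> are
  significant: m and n are carried as explicit parameters wherever they matter, and equality of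
  tensors means equality on that set. Likewise a vector of dimension n is a function on the
  naturals of which only the values on 1,...,n are significant.
\<close>

type_synonym tensor = "nat list \<Rightarrow> real"
type_synonym vect = "nat \<Rightarrow> real"

definition indices :: "nat \<Rightarrow> nat \<Rightarrow> nat list set" where
  "indices m n = {I. length I = m \<and> set I \<subseteq> {1..n}}"

lemma finite_indices [simp]: "finite (indices m n)"
  using finite_lists_length_eq[of "{1..n}" m] by (simp add: indices_def conj_commute)

definition nonneg_tensor :: "nat \<Rightarrow> nat \<Rightarrow> tensor \<Rightarrow> bool" where
  "nonneg_tensor m n A \<longleftrightarrow> (\<forall>I\<in>indices m n. 0 \<le> A I)"

definition nonneg_vect :: "nat \<Rightarrow> vect \<Rightarrow> bool" where
  "nonneg_vect n u \<longleftrightarrow> (\<forall>i\<in>{1..n}. 0 \<le> u i)"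

text \<open>The rank-one tensor of u; its order is the length of the argument tuple.\<close>

definition rank_one :: "vect \<Rightarrow> tensor" where
  "rank_one u I = (\<Prod>i\<leftarrow>I. u i)"

definition completely_positive :: "nat \<Rightarrow> nat \<Rightarrow> tensor \<Rightarrow> bool" where
  "completely_positive m n A \<longleftrightarrow>
     (\<exists>(r::nat) (u :: nat \<Rightarrow> vect).
        (\<forall>k\<in>{1..r}. nonneg_vect n (u k)) \<and>
        (\<forall>I\<in>indices m n. A I = (\<Sum>k=1..r. rank_one (u k) I)))"

definition idx_le :: "nat list \<Rightarrow> nat list \<Rightarrow> bool"  (infix "\<preceq>" 50) where
  "I \<preceq> J \<longleftrightarrow> set I \<subseteq> set J"

definition idx_sim :: "nat list \<Rightarrow> nat list \<Rightarrow> bool"  (infix "\<sim>" 50) where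
  "I \<sim> J \<longleftrightarrow> set I = set J"

definition strongly_symmetric :: "nat \<Rightarrow> nat \<Rightarrow> tensor \<Rightarrow> bool" where
  "strongly_symmetric m n A \<longleftrightarrow>
     (\<forall>I\<in>indices m n. \<forall>J\<in>indices m n. I \<sim> J \<longrightarrow> A I = A J)"

text \<open>
  The tuples that start with k strictly increasing indices and repeat the last of them up to
  length m; empty unless k is between 1 and m.
\<close>

definition idx_plus :: "nat \<Rightarrow> nat \<Rightarrow> nat \<Rightarrow> nat list set" where
  "idx_plus m n k =
     {is @ replicate (m - k) (last is) | is.
        1 \<le> k \<and> k \<le> m \<and> length is = k \<and> set is \<subseteq> {1..n} \<and> sorted_wrt (<) is}"

lemma idx_plus_subset_indices: "idx_plus m n k \<subseteq> indices m n"
proof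
  fix I assume "I \<in> idx_plus m n k"
  then obtain xs where xs: "I = xs @ replicate (m - k) (last xs)" "1 \<le> k" "k \<le> m"
      "length xs = k" "set xs \<subseteq> {1..n}"
    by (auto simp: idx_plus_def)
  then have "last xs \<in> set xs" by (intro last_in_set) auto
  with xs show "I \<in> indices m n" by (auto simp: indices_def set_replicate_conv_if)
qed

lemma finite_idx_plus [simp]: "finite (idx_plus m n k)"
  using idx_plus_subset_indices finite_indices by (rule finite_subset)

definition idx_plus_supp :: "nat \<Rightarrow> nat \<Rightarrow> nat \<Rightarrow> tensor \<Rightarrow> nat list set" where
  "idx_plus_supp m n k A = {e \<in> idx_plus m n k. A e \<noteq> 0}"

definition J1 :: "nat \<Rightarrow> nat \<Rightarrow> nat \<Rightarrow> nat list \<Rightarrow> nat list set" where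
  "J1 m n p I = {J \<in> idx_plus m n (p + 1). I \<preceq> J}"

definition hierarchically_dominated :: "nat \<Rightarrow> nat \<Rightarrow> tensor \<Rightarrow> bool" where
  "hierarchically_dominated m n A \<longleftrightarrow>
     (\<forall>p\<in>{1..m - 1}. \<forall>I\<in>idx_plus m n p. (\<Sum>J\<in>J1 m n p I. A J) \<le> A I)"

definition indicator_vect :: "nat list \<Rightarrow> vect" where
  "indicator_vect e i = (if i \<in> set e then 1 else 0)"

text \<open>
  The tensor after k steps of the hierarchical elimination algorithm. The algorithm performs m
  steps; for \<open>k \<ge> m\<close> the sum below is empty and nothing changes any more.
\<close>

primrec hier_elim :: "nat \<Rightarrow> nat \<Rightarrow> tensor \<Rightarrow> nat \<Rightarrow> tensor" where
  "hier_elim m n A 0 = A"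
| "hier_elim m n A (Suc k) =
     (\<lambda>I. hier_elim m n A k I -
        (\<Sum>e\<in>idx_plus_supp m n (m - k) (hier_elim m n A k).
            hier_elim m n A k e * rank_one (indicator_vect e) I))"

end

theory Submission
  imports Defs
begin

text \<open>
  A strongly symmetric tensor is a function \<open>f\<close> of the supports of its index tuples, that is, of
  the nonempty subsets \<open>S\<close> of \<open>V = {1..n}\<close> with at most \<open>m\<close> elements. In these terms hierarchical
  dominance says that \<open>f S\<close> is at least the sum of \<open>f\<close> over the sets that extend \<open>S\<close> by one
  element, and one step of the algorithm is a sweep of some level \<open>q\<close>: it subtracts from \<open>f S\<close> the
  sum of \<open>f U\<close> over all \<open>q\<close>-element sets \<open>U\<close> containing \<open>S\<close>.

  Dominance alone controls signs: if \<open>f\<close> is nonnegative on the \<open>m\<close>-element sets, it is nonnegative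
  on each lower level in turn (\<open>dominated_nonneg\<close>). So it suffices that a sweep keeps dominance.
  For \<open>S\<close> with \<open>p < q\<close> elements, each \<open>q\<close>-element \<open>U \<supseteq> S\<close> contains \<open>q - p\<close> one-element extensions
  of \<open>S\<close> (\<open>sum_over_one_step_extensions\<close>). The sweep thus lowers \<open>f S\<close> by one copy of
  \<open>\<Sum> f U\<close> but lowers the sum over the extensions by \<open>q - p \<ge> 1\<close> copies of it, so the slack in
  the dominance inequality can only grow (\<open>sweep_dominated\<close>). A sweep of level \<open>q\<close> also makes
  that level vanish. Sweeping the levels \<open>m, m - 1, \<dots>, 1\<close> therefore keeps every intermediate
  tensor nonnegative and ends with the zero tensor.

  Complete positivity follows by undoing the steps: each of them has subtracted a nonnegative
  combination of rank-one tensors of 0-1 vectors, and completely positive tensors form a convex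
  cone.
\<close>

section \<open>Dominated set functions\<close>

definition supersets_of_card :: "'a set \<Rightarrow> nat \<Rightarrow> 'a set \<Rightarrow> 'a set set" where
  "supersets_of_card V q S = {T. S \<subseteq> T \<and> T \<subseteq> V \<and> card T = q}"

definition dominated :: "'a set \<Rightarrow> nat \<Rightarrow> ('a set \<Rightarrow> real) \<Rightarrow> bool" where
  "dominated V m f \<longleftrightarrow>
     (\<forall>S\<subseteq>V. 1 \<le> card S \<and> card S < m \<longrightarrow>
        (\<Sum>T\<in>supersets_of_card V (card S + 1) S. f T) \<le> f S)"

definition sweep :: "'a set \<Rightarrow> nat \<Rightarrow> ('a set \<Rightarrow> real) \<Rightarrow> 'a set \<Rightarrow> real" where
  "sweep V q f S = f S - (\<Sum>T\<in>supersets_of_card V q S. f T)"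

lemma finite_supersets_of_card: "finite V \<Longrightarrow> finite (supersets_of_card V q S)"
  unfolding supersets_of_card_def by (rule finite_subset[of _ "Pow V"]) auto

lemma supersets_of_own_card:
  assumes "finite V" "S \<subseteq> V"
  shows "supersets_of_card V (card S) S = {S}"
proof -
  have "T = S" if "S \<subseteq> T" "T \<subseteq> V" "card T = card S" for T
    using that card_subset_eq[of T S] finite_subset[OF that(2) assms(1)] by simp
  then show ?thesis
    using assms(2) by (auto simp: supersets_of_card_def)
qed

lemma supersets_of_smaller_card:
  assumes "finite V" "q < card S"
  shows "supersets_of_card V q S = {}"
proof -
  have False if "T \<in> supersets_of_card V q S" for T
  proof -
    have T: "S \<subseteq> T" "T \<subseteq> V" "card T = q"
      using that by (simp_all add: supersets_of_card_def)
    have "card S \<le> card T"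
      by (rule card_mono[OF finite_subset[OF T(2) assms(1)] T(1)])
    with T(3) assms(2) show False
      by simp
  qed
  then show ?thesis
    by blast
qed

lemma card_one_step_extensions:
  assumes "finite U" "S \<subseteq> U"
  shows "card {T. S \<subseteq> T \<and> T \<subseteq> U \<and> card T = card S + 1} = card U - card S"
proof -
  have fin: "finite S"
    using assms finite_subset by blast
  have "{T. S \<subseteq> T \<and> T \<subseteq> U \<and> card T = card S + 1} = (\<lambda>x. insert x S) ` (U - S)"
  proof (intro subset_antisym subsetI)
    fix T assume T: "T \<in> {T. S \<subseteq> T \<and> T \<subseteq> U \<and> card T = card S + 1}"
    then have "card (T - S) = 1"
      using fin by (simp add: card_Diff_subset)
    then obtain x where "T - S = {x}"
      by (auto simp: card_1_singleton_iff)
    with T show "T \<in> (\<lambda>x. insert x S) ` (U - S)"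
      by (intro image_eqI[of _ _ x]) auto
  qed (use fin assms in auto)
  moreover have "inj_on (\<lambda>x. insert x S) (U - S)"
    by (rule inj_onI) blast
  ultimately show ?thesis
    using assms fin by (simp add: card_image card_Diff_subset)
qed

text \<open>
  Double counting of the chains \<open>S \<subset> T \<subseteq> U\<close>: every \<open>U\<close> is reached through one \<open>T\<close> for each
  element of \<open>U - S\<close>.
\<close>

lemma sum_over_one_step_extensions:
  fixes f :: "'a set \<Rightarrow> real"
  assumes V: "finite V"
  shows "(\<Sum>T\<in>supersets_of_card V (card S + 1) S. \<Sum>U\<in>supersets_of_card V q T. f U) =
         real (q - card S) * (\<Sum>U\<in>supersets_of_card V q S. f U)"
proof -
  have "(\<Sum>T\<in>supersets_of_card V (card S + 1) S. \<Sum>U\<in>supersets_of_card V q T. f U) =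
        (\<Sum>T\<in>supersets_of_card V (card S + 1) S.
           \<Sum>U\<in>{U \<in> supersets_of_card V q S. T \<subseteq> U}. f U)"
    by (intro sum.cong) (auto simp: supersets_of_card_def)
  also have "\<dots> = (\<Sum>U\<in>supersets_of_card V q S.
           \<Sum>T\<in>{T \<in> supersets_of_card V (card S + 1) S. T \<subseteq> U}. f U)"
    by (rule sum.swap_restrict) (simp_all add: V finite_supersets_of_card)
  also have "\<dots> = (\<Sum>U\<in>supersets_of_card V q S. real (q - card S) * f U)"
  proof (rule sum.cong)
    fix U assume U: "U \<in> supersets_of_card V q S"
    have "{T \<in> supersets_of_card V (card S + 1) S. T \<subseteq> U} =
          {T. S \<subseteq> T \<and> T \<subseteq> U \<and> card T = card S + 1}"
      using U by (auto simp: supersets_of_card_def)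
    moreover have "finite U" "S \<subseteq> U" "card U = q"
      using U V by (auto simp: supersets_of_card_def dest: finite_subset)
    ultimately show "(\<Sum>T\<in>{T \<in> supersets_of_card V (card S + 1) S. T \<subseteq> U}. f U) =
        real (q - card S) * f U"
      by (simp only: sum_constant card_one_step_extensions)
  qed simp
  finally show ?thesis
    by (simp add: sum_distrib_left)
qed

text \<open>
  Dominance bounds each value below by a sum of values one level up, so nonnegativity descends
  from the top level to all the others.
\<close>

lemma dominated_nonneg:
  assumes dom: "dominated V m f"
    and top: "\<And>S. S \<subseteq> V \<Longrightarrow> card S = m \<Longrightarrow> 0 \<le> f S"
    and "S \<subseteq> V" "1 \<le> card S" "card S \<le> m"
  shows "0 \<le> f S"
  using assms(3-5)
proof (induction "m - card S" arbitrary: S)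
  case 0
  then show ?case
    using top by simp
next
  case (Suc d)
  have "0 \<le> f T" if "T \<in> supersets_of_card V (card S + 1) S" for T
  proof (rule Suc.hyps)
    show "d = m - card T" "T \<subseteq> V" "1 \<le> card T" "card T \<le> m"
      using that Suc.hyps(2) by (auto simp: supersets_of_card_def)
  qed
  then have "0 \<le> (\<Sum>T\<in>supersets_of_card V (card S + 1) S. f T)"
    by (intro sum_nonneg)
  also have "\<dots> \<le> f S"
    using dom Suc.prems Suc.hyps(2) by (simp add: dominated_def)
  finally show ?case .
qed

lemma sweep_vanishes:
  assumes "finite V" "S \<subseteq> V" "q \<le> card S" "q < card S \<Longrightarrow> f S = 0"
  shows "sweep V q f S = 0"
proof (cases "q = card S")
  case True
  then show ?thesis
    by (simp add: sweep_def supersets_of_own_card[OF assms(1,2)])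
next
  case False
  with assms(3) have "q < card S"
    by simp
  then show ?thesis
    using assms(4) by (simp add: sweep_def supersets_of_smaller_card[OF assms(1)])
qed

text \<open>
  The slack of the swept function at \<open>S\<close> is the slack of \<open>f\<close> plus \<open>q - card S - 1\<close> times the
  (nonnegative) sum of \<open>f\<close> over the \<open>q\<close>-element supersets of \<open>S\<close>. From level \<open>q\<close> upwards the
  swept function is zero, and there is nothing to compare.
\<close>

lemma sweep_dominated:
  assumes V: "finite V"
    and dom: "dominated V m f"
    and above: "\<And>S. S \<subseteq> V \<Longrightarrow> q < card S \<Longrightarrow> card S \<le> m \<Longrightarrow> f S = 0"
    and level: "\<And>S. S \<subseteq> V \<Longrightarrow> card S = q \<Longrightarrow> 0 \<le> f S"
  shows "dominated V m (sweep V q f)"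
  unfolding dominated_def
proof (intro allI impI)
  fix S assume S: "S \<subseteq> V" and cS: "1 \<le> card S \<and> card S < m"
  let ?E = "supersets_of_card V (card S + 1) S"
  let ?X = "\<Sum>U\<in>supersets_of_card V q S. f U"
  show "(\<Sum>T\<in>?E. sweep V q f T) \<le> sweep V q f S"
  proof (cases "card S < q")
    case True
    have "0 \<le> ?X"
      by (intro sum_nonneg level) (auto simp: supersets_of_card_def)
    then have "1 * ?X \<le> real (q - card S) * ?X"
      using True by (intro mult_right_mono) auto
    moreover have "(\<Sum>T\<in>?E. f T) \<le> f S"
      using dom S cS by (simp add: dominated_def)
    moreover have "(\<Sum>T\<in>?E. sweep V q f T) = (\<Sum>T\<in>?E. f T) - real (q - card S) * ?X"
      unfolding sweep_def sum_subtractf sum_over_one_step_extensions[OF V] ..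
    ultimately show ?thesis
      unfolding sweep_def by linarith
  next
    case False
    have "sweep V q f T = 0" if "T \<in> ?E" for T
      using that False cS by (intro sweep_vanishes V above) (auto simp: supersets_of_card_def)
    moreover have "sweep V q f S = 0"
      using S False cS by (intro sweep_vanishes V above) auto
    ultimately show ?thesis
      by simp
  qed
qed

section \<open>Index tuples and their supports\<close>

text \<open>
  The member of \<open>idx_plus m n k\<close> with a prescribed \<open>k\<close>-element support. Reading off a strongly
  symmetric tensor at these tuples turns it into a set function.
\<close>

definition canonical_tuple :: "nat \<Rightarrow> nat set \<Rightarrow> nat list" where
  "canonical_tuple m S =
     (let xs = sorted_list_of_set S in xs @ replicate (m - card S) (last xs))"

definition on_supports :: "nat \<Rightarrow> tensor \<Rightarrow> nat set \<Rightarrow> real" where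
  "on_supports m A S = A (canonical_tuple m S)"

lemma canonical_tuple_in_idx_plus:
  assumes "S \<subseteq> {1..n}" "1 \<le> card S" "card S \<le> m"
  shows "canonical_tuple m S \<in> idx_plus m n (card S)"
proof -
  have "finite S"
    using assms(1) finite_subset by blast
  then show ?thesis
    using assms unfolding idx_plus_def canonical_tuple_def Let_def
    by (auto intro!: exI[of _ "sorted_list_of_set S"])
qed

lemma set_append_replicate_last:
  assumes "xs \<noteq> []"
  shows "set (xs @ replicate d (last xs)) = set xs"
  using assms by (auto simp: set_replicate_conv_if)

lemma set_canonical_tuple:
  assumes "finite S" "S \<noteq> {}"
  shows "set (canonical_tuple m S) = S"
  using assms by (simp add: canonical_tuple_def Let_def set_append_replicate_last del: set_append)

lemma idx_plus_canonical:
  assumes "e \<in> idx_plus m n k"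
  shows "set e \<subseteq> {1..n}" "card (set e) = k" "e = canonical_tuple m (set e)"
proof -
  obtain xs where xs: "e = xs @ replicate (m - k) (last xs)" "1 \<le> k" "k \<le> m"
      "length xs = k" "set xs \<subseteq> {1..n}" "sorted_wrt (<) xs"
    using assms by (auto simp: idx_plus_def)
  have "xs \<noteq> []"
    using xs(2,4) by auto
  then have e: "set e = set xs"
    unfolding xs(1) by (rule set_append_replicate_last)
  have sorted: "sorted xs" "distinct xs"
    using xs(6) by (simp_all only: strict_sorted_iff)
  have sl: "sorted_list_of_set (set xs) = xs"
    using sorted by (rule sorted_list_of_set.idem_if_sorted_distinct)
  show "set e \<subseteq> {1..n}"
    unfolding e by (rule xs(5))
  show card: "card (set e) = k"
    unfolding e distinct_card[OF sorted(2)] by (rule xs(4))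
  show "e = canonical_tuple m (set e)"
    unfolding canonical_tuple_def Let_def card unfolding e sl by (rule xs(1))
qed

lemma bij_betw_set_idx_plus:
  assumes "1 \<le> k" "k \<le> m"
  shows "bij_betw set {e \<in> idx_plus m n k. S \<subseteq> set e} (supersets_of_card {1..n} k S)"
proof (rule bij_betw_byWitness[where f' = "canonical_tuple m"])
  have canon: "set (canonical_tuple m T) = T" if "T \<in> supersets_of_card {1..n} k S" for T
    using that assms finite_subset[of T "{1..n}"]
    by (intro set_canonical_tuple) (auto simp: supersets_of_card_def)
  show "\<forall>e\<in>{e \<in> idx_plus m n k. S \<subseteq> set e}. canonical_tuple m (set e) = e"
    using idx_plus_canonical(3) by (metis (no_types, lifting) mem_Collect_eq)
  show "\<forall>T\<in>supersets_of_card {1..n} k S. set (canonical_tuple m T) = T"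
    using canon by blast
  show "set ` {e \<in> idx_plus m n k. S \<subseteq> set e} \<subseteq> supersets_of_card {1..n} k S"
    unfolding supersets_of_card_def using idx_plus_canonical(1,2) by blast
  show "canonical_tuple m ` supersets_of_card {1..n} k S \<subseteq> {e \<in> idx_plus m n k. S \<subseteq> set e}"
    using canon canonical_tuple_in_idx_plus[of _ n m] assms
    by (auto simp: supersets_of_card_def)
qed

lemma sum_idx_plus_eq_sum_supersets:
  assumes "1 \<le> k" "k \<le> m"
  shows "(\<Sum>e\<in>{e \<in> idx_plus m n k. S \<subseteq> set e}. A e) =
         (\<Sum>T\<in>supersets_of_card {1..n} k S. on_supports m A T)"
proof -
  have "(\<Sum>e\<in>{e \<in> idx_plus m n k. S \<subseteq> set e}. A e) =
        (\<Sum>e\<in>{e \<in> idx_plus m n k. S \<subseteq> set e}. on_supports m A (set e))"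
    by (intro sum.cong) (auto simp: on_supports_def simp flip: idx_plus_canonical(3))
  also have "\<dots> = (\<Sum>T\<in>supersets_of_card {1..n} k S. on_supports m A T)"
    by (rule sum.reindex_bij_betw[OF bij_betw_set_idx_plus[OF assms]])
  finally show ?thesis .
qed

lemma support_of_index:
  assumes "I \<in> indices m n" "1 \<le> m"
  shows "set I \<subseteq> {1..n}" "1 \<le> card (set I)" "card (set I) \<le> m"
  using assms card_length[of I]
  by (auto simp: indices_def Suc_le_eq card_gt_0_iff)

lemma canonical_tuple_in_indices:
  assumes "S \<subseteq> {1..n}" "1 \<le> card S" "card S \<le> m"
  shows "canonical_tuple m S \<in> indices m n" "set (canonical_tuple m S) = S"
proof -
  show "canonical_tuple m S \<in> indices m n"
    using canonical_tuple_in_idx_plus[OF assms] idx_plus_subset_indices by blast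
  have "finite S"
    using assms(1) finite_subset by blast
  then show "set (canonical_tuple m S) = S"
    using assms(2) by (intro set_canonical_tuple) auto
qed

lemma strongly_symmetric_on_supports:
  assumes "strongly_symmetric m n A" "I \<in> indices m n" "1 \<le> m"
  shows "A I = on_supports m A (set I)"
proof -
  note canon = canonical_tuple_in_indices[OF support_of_index[OF assms(2,3)]]
  show ?thesis
    using assms(1,2) canon(1) canon(2)[symmetric]
    unfolding strongly_symmetric_def on_supports_def idx_sim_def by blast
qed

lemma dominated_on_supports:
  assumes "hierarchically_dominated m n A"
  shows "dominated {1..n} m (on_supports m A)"
  unfolding dominated_def
proof (intro allI impI)
  fix S assume S: "S \<subseteq> {1..n}" and cS: "1 \<le> card S \<and> card S < m"
  let ?I = "canonical_tuple m S"
  have I: "?I \<in> idx_plus m n (card S)" "set ?I = S"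
    using canonical_tuple_in_idx_plus[OF S] canonical_tuple_in_indices(2)[OF S] cS by simp_all
  then have J1: "J1 m n (card S) ?I = {e \<in> idx_plus m n (card S + 1). S \<subseteq> set e}"
    by (simp add: J1_def idx_le_def)
  have "card S \<in> {1..m - 1}"
    using cS by auto
  then have "(\<Sum>e\<in>J1 m n (card S) ?I. A e) \<le> A ?I"
    using assms I(1) unfolding hierarchically_dominated_def by blast
  then have "(\<Sum>e\<in>{e \<in> idx_plus m n (card S + 1). S \<subseteq> set e}. A e) \<le> on_supports m A S"
    unfolding J1 on_supports_def .
  then show "(\<Sum>T\<in>supersets_of_card {1..n} (card S + 1) S. on_supports m A T)
      \<le> on_supports m A S"
    using cS by (simp add: sum_idx_plus_eq_sum_supersets)
qed

section \<open>Elimination as a sequence of sweeps\<close>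

lemma rank_one_indicator: "rank_one (indicator_vect e) I = (if set I \<subseteq> set e then 1 else 0)"
  by (induction I) (auto simp: rank_one_def indicator_vect_def)

lemma hier_elim_Suc_eq:
  assumes "k < m"
  shows "hier_elim m n A (Suc k) I = hier_elim m n A k I -
           (\<Sum>T\<in>supersets_of_card {1..n} (m - k) (set I). on_supports m (hier_elim m n A k) T)"
proof -
  let ?B = "hier_elim m n A k"
  have "(\<Sum>e\<in>idx_plus_supp m n (m - k) ?B. ?B e * rank_one (indicator_vect e) I) =
        (\<Sum>e\<in>{e \<in> idx_plus m n (m - k). set I \<subseteq> set e}. ?B e)"
    by (intro sum.mono_neutral_cong)
       (auto simp: idx_plus_supp_def rank_one_indicator finite_subset[OF _ finite_idx_plus])
  also have "\<dots> = (\<Sum>T\<in>supersets_of_card {1..n} (m - k) (set I). on_supports m ?B T)"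
    using assms by (intro sum_idx_plus_eq_sum_supersets) auto
  finally show ?thesis
    by (simp only: hier_elim.simps)
qed

lemma on_supports_hier_elim_Suc:
  assumes "k < m" "S \<subseteq> {1..n}" "1 \<le> card S" "card S \<le> m"
  shows "on_supports m (hier_elim m n A (Suc k)) S =
         sweep {1..n} (m - k) (on_supports m (hier_elim m n A k)) S"
  unfolding sweep_def on_supports_def[of m "hier_elim m n A (Suc k)"]
    hier_elim_Suc_eq[OF assms(1)] canonical_tuple_in_indices(2)[OF assms(2-4)]
  by (simp only: on_supports_def)

lemma strongly_symmetric_hier_elim:
  assumes "strongly_symmetric m n A" "k \<le> m"
  shows "strongly_symmetric m n (hier_elim m n A k)"
  using assms(2)
proof (induction k)
  case (Suc k)
  show ?case
    unfolding strongly_symmetric_def idx_sim_def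
  proof (intro ballI impI)
    fix I J assume I: "I \<in> indices m n" and J: "J \<in> indices m n" and eq: "set I = set J"
    have "hier_elim m n A k I = hier_elim m n A k J"
      using Suc I J eq unfolding strongly_symmetric_def idx_sim_def by (meson Suc_leD)
    moreover have "k < m"
      using Suc.prems by simp
    ultimately show "hier_elim m n A (Suc k) I = hier_elim m n A (Suc k) J"
      by (simp only: hier_elim_Suc_eq eq)
  qed
qed (simp add: assms)

text \<open>
  The invariant of the algorithm: dominance persists, the levels already swept vanish, and the
  remaining ones are nonnegative. The signs follow from dominance and the top level, which is
  nonnegative at the start and zero after the first step.
\<close>

lemma hier_elim_invariant:
  assumes "nonneg_tensor m n A" "hierarchically_dominated m n A" "1 \<le> m" "k \<le> m"
  defines "F \<equiv> \<lambda>k. on_supports m (hier_elim m n A k)"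
  shows "dominated {1..n} m (F k)"
    and "\<And>S. S \<subseteq> {1..n} \<Longrightarrow> m - k < card S \<Longrightarrow> card S \<le> m \<Longrightarrow> F k S = 0"
    and "\<And>S. S \<subseteq> {1..n} \<Longrightarrow> 1 \<le> card S \<Longrightarrow> card S \<le> m \<Longrightarrow> 0 \<le> F k S"
proof -
  have "dominated {1..n} m (F k) \<and>
        (\<forall>S\<subseteq>{1..n}. m - k < card S \<and> card S \<le> m \<longrightarrow> F k S = 0) \<and>
        (\<forall>S\<subseteq>{1..n}. 1 \<le> card S \<and> card S \<le> m \<longrightarrow> 0 \<le> F k S)"
    using assms(4)
  proof (induction k)
    case 0
    have "0 \<le> F 0 S" if "S \<subseteq> {1..n}" "1 \<le> card S" "card S \<le> m" for S
      using assms(1) canonical_tuple_in_indices(1)[OF that]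
      by (simp add: F_def on_supports_def nonneg_tensor_def)
    then show ?case
      using dominated_on_supports[OF assms(2)] by (simp add: F_def)
  next
    case (Suc k)
    have k: "k < m"
      using Suc.prems by simp
    then have dom: "dominated {1..n} m (F k)"
      and zero: "\<And>S. S \<subseteq> {1..n} \<Longrightarrow> m - k < card S \<Longrightarrow> card S \<le> m \<Longrightarrow> F k S = 0"
      and nonneg: "\<And>S. S \<subseteq> {1..n} \<Longrightarrow> 1 \<le> card S \<Longrightarrow> card S \<le> m \<Longrightarrow> 0 \<le> F k S"
      using Suc.IH[OF less_imp_le] by blast+
    let ?G = "sweep {1..n} (m - k) (F k)"
    have step: "F (Suc k) S = ?G S" if "S \<subseteq> {1..n}" "1 \<le> card S" "card S \<le> m" for S
      unfolding F_def using on_supports_hier_elim_Suc[OF k that] .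
    have "dominated {1..n} m ?G"
      using k by (intro sweep_dominated dom zero nonneg) auto
    moreover have "(\<Sum>T\<in>supersets_of_card {1..n} (card S + 1) S. F (Suc k) T) =
        (\<Sum>T\<in>supersets_of_card {1..n} (card S + 1) S. ?G T)" if "card S < m" for S
      using that by (intro sum.cong step) (auto simp: supersets_of_card_def)
    ultimately have dom': "dominated {1..n} m (F (Suc k))"
      unfolding dominated_def by (simp add: step)
    have zero': "F (Suc k) S = 0" if "S \<subseteq> {1..n}" "m - Suc k < card S" "card S \<le> m" for S
    proof -
      have "m - k \<le> card S"
        using that(2) k by simp
      then have "?G S = 0"
        by (intro sweep_vanishes finite_atLeastAtMost that(1) zero that(3))
      moreover have "1 \<le> card S"
        using that(2) by simp
      ultimately show ?thesis
        using step[OF that(1) _ that(3)] by simp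
    qed
    have "0 \<le> F (Suc k) S" if "S \<subseteq> {1..n}" "1 \<le> card S" "card S \<le> m" for S
      using dom' _ that
    proof (rule dominated_nonneg)
      \<comment> \<open>At least one level has been swept by now, so the top level is zero.\<close>
      show "0 \<le> F (Suc k) S" if "S \<subseteq> {1..n}" "card S = m" for S
        using zero'[of S] that k by simp
    qed
    with dom' zero' show ?case
      by blast
  qed
  then show "dominated {1..n} m (F k)"
    "\<And>S. S \<subseteq> {1..n} \<Longrightarrow> m - k < card S \<Longrightarrow> card S \<le> m \<Longrightarrow> F k S = 0"
    "\<And>S. S \<subseteq> {1..n} \<Longrightarrow> 1 \<le> card S \<Longrightarrow> card S \<le> m \<Longrightarrow> 0 \<le> F k S"
    by blast+
qed

section \<open>The cone of completely positive tensors\<close>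

lemma completely_positive_cong:
  assumes "completely_positive m n A" "\<And>I. I \<in> indices m n \<Longrightarrow> A I = B I"
  shows "completely_positive m n B"
  using assms by (auto simp: completely_positive_def)

lemma completely_positive_zero: "completely_positive m n (\<lambda>I. 0)"
  unfolding completely_positive_def by (rule exI[of _ 0]) auto

lemma completely_positive_add:
  assumes "completely_positive m n A" "completely_positive m n B"
  shows "completely_positive m n (\<lambda>I. A I + B I)"
proof -
  obtain r :: nat and u where u: "\<forall>k\<in>{1..r}. nonneg_vect n (u k)"
      "\<forall>I\<in>indices m n. A I = (\<Sum>k=1..r. rank_one (u k) I)"
    using assms(1) unfolding completely_positive_def by blast
  obtain s :: nat and v where v: "\<forall>k\<in>{1..s}. nonneg_vect n (v k)"
      "\<forall>I\<in>indices m n. B I = (\<Sum>k=1..s. rank_one (v k) I)"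
    using assms(2) unfolding completely_positive_def by blast
  define w where "w k = (if k \<le> r then u k else v (k - r))" for k
  have "nonneg_vect n (w k)" if "k \<in> {1..r + s}" for k
  proof (cases "k \<le> r")
    case True
    with that u(1) show ?thesis
      by (simp add: w_def)
  next
    case False
    with that have "k - r \<in> {1..s}"
      by auto
    with False v(1) show ?thesis
      by (simp add: w_def)
  qed
  moreover have "A I + B I = (\<Sum>k=1..r + s. rank_one (w k) I)" if I: "I \<in> indices m n" for I
  proof -
    have "(\<Sum>k=1..r + s. rank_one (w k) I) =
        (\<Sum>k=1..r. rank_one (w k) I) + (\<Sum>k=r + 1..r + s. rank_one (w k) I)"
      by (rule sum.ub_add_nat) simp
    moreover have "(\<Sum>k=1..r. rank_one (w k) I) = A I"
      unfolding bspec[OF u(2) I] by (intro sum.cong) (auto simp: w_def)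
    moreover have "(\<Sum>k=r + 1..r + s. rank_one (w k) I) = (\<Sum>k=1..s. rank_one (w (k + r)) I)"
      using sum.shift_bounds_cl_nat_ivl[of "\<lambda>k. rank_one (w k) I" 1 r s]
      by (simp only: add.commute)
    moreover have "(\<Sum>k=1..s. rank_one (w (k + r)) I) = B I"
      unfolding bspec[OF v(2) I] by (intro sum.cong) (auto simp: w_def)
    ultimately show ?thesis
      by linarith
  qed
  ultimately show ?thesis
    unfolding completely_positive_def by blast
qed

lemma completely_positive_sum:
  assumes "finite E" "\<And>e. e \<in> E \<Longrightarrow> completely_positive m n (g e)"
  shows "completely_positive m n (\<lambda>I. \<Sum>e\<in>E. g e I)"
  using assms
proof induction
  case empty
  show ?case
    by (simp add: completely_positive_zero)
next
  case (insert e E)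
  then have "completely_positive m n (\<lambda>I. g e I + (\<Sum>e\<in>E. g e I))"
    by (intro completely_positive_add) simp_all
  with insert.hyps show ?case
    by simp
qed

lemma rank_one_scale: "rank_one (\<lambda>i. c * u i) I = c ^ length I * rank_one u I"
  by (induction I) (auto simp: rank_one_def)

text \<open>The coefficient is absorbed into the vector by taking its \<open>m\<close>-th root.\<close>

lemma completely_positive_scaled_rank_one:
  assumes "1 \<le> m" "0 \<le> c" "nonneg_vect n u"
  shows "completely_positive m n (\<lambda>I. c * rank_one u I)"
proof -
  let ?w = "\<lambda>i. root m c * u i"
  have "nonneg_vect n ?w"
    using assms by (auto simp: nonneg_vect_def)
  moreover have "c * rank_one u I = rank_one ?w I" if "I \<in> indices m n" for I
    using that assms by (simp add: rank_one_scale indices_def)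
  ultimately show ?thesis
    unfolding completely_positive_def by (intro exI[of _ 1] exI[of _ "\<lambda>_. ?w"]) simp
qed

theorem theorem7:
  fixes m n :: nat and A :: tensor
  assumes "1 \<le> m" and "1 \<le> n"
    and "nonneg_tensor m n A"
    and "strongly_symmetric m n A"
    and "hierarchically_dominated m n A"
  shows "(\<forall>k\<in>{0..m - 1}. nonneg_tensor m n (hier_elim m n A k)) \<and>
         completely_positive m n A"
proof
  note inv = hier_elim_invariant[OF assms(3,5,1)]
  have entry: "hier_elim m n A k I = on_supports m (hier_elim m n A k) (set I)"
    if "k \<le> m" "I \<in> indices m n" for k I
    using strongly_symmetric_hier_elim[OF assms(4) that(1)] that(2) assms(1)
    by (rule strongly_symmetric_on_supports)
  have nonneg: "nonneg_tensor m n (hier_elim m n A k)" if "k \<le> m" for k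
    unfolding nonneg_tensor_def
  proof
    fix I assume I: "I \<in> indices m n"
    show "0 \<le> hier_elim m n A k I"
      unfolding entry[OF that I] by (rule inv(3)[OF that support_of_index[OF I assms(1)]])
  qed
  then show "\<forall>k\<in>{0..m - 1}. nonneg_tensor m n (hier_elim m n A k)"
    by auto
  have "completely_positive m n (hier_elim m n A 0)"
  proof (rule inc_induct[where P = "\<lambda>k. completely_positive m n (hier_elim m n A k)"])
    show "0 \<le> m" by simp
    show "completely_positive m n (hier_elim m n A m)"
    proof (rule completely_positive_cong[OF completely_positive_zero])
      fix I assume I: "I \<in> indices m n"
      show "0 = hier_elim m n A m I"
        using entry[OF order_refl I] inv(2)[OF order_refl, of "set I"]
          support_of_index[OF I assms(1)] by simp
    qed
  next
    fix k assume k: "k < m" and IH: "completely_positive m n (hier_elim m n A (Suc k))"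
    let ?B = "hier_elim m n A k"
    let ?E = "idx_plus_supp m n (m - k) ?B"
    have E: "?E \<subseteq> indices m n"
      using idx_plus_subset_indices by (auto simp: idx_plus_supp_def)
    have "completely_positive m n (\<lambda>I. ?B e * rank_one (indicator_vect e) I)" if "e \<in> ?E" for e
    proof (rule completely_positive_scaled_rank_one[OF assms(1)])
      show "0 \<le> ?B e"
        using nonneg[OF less_imp_le[OF k]] subsetD[OF E that] unfolding nonneg_tensor_def by blast
      show "nonneg_vect n (indicator_vect e)"
        by (simp add: nonneg_vect_def indicator_vect_def)
    qed
    then have "completely_positive m n (\<lambda>I. \<Sum>e\<in>?E. ?B e * rank_one (indicator_vect e) I)"
      by (rule completely_positive_sum[OF finite_subset[OF E finite_indices]])
    from completely_positive_add[OF IH this] show "completely_positive m n ?B"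
      by simp
  qed
  then show "completely_positive m n A"
    by simp
qed

end
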